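(* The first eigenvalue $\lambda(p)$ satisfies $$p<\lambda(p)<p+\frac{\pi^2}{6}-1 \quad \text{for } 2\leq p<\infty,$$ and $$\left(\frac{p}{p-1}\right)^{p-1}<\lambda(p)<(p-1)^{1-p}\left(1+\frac{\pi^2}{6}(p-1)\right)^{p-1} \quad \text{for } 1<p<2.$$
   Context: For $1<p<\infty$, $\lambda(p)$ denotes the first (smallest) eigenvalue of the one-dimensional $p$-Laplacian on $(-1,1)$ with Dirichlet boundary conditions, i.e. the smallest $\lambda$ for which $(|u'|^{p-2}u')'+\lambda|u|^{p-2}u=0$ in $(-1,1)$, $u(-1)=u(1)=0$ has a nontrivial solution. It is known to be given explicitly by $$\lambda(p)=(p-1)\left(\frac{\pi}{p\sin(\pi/p)}\right)^p,$$ and this formula may be taken as the definition of $\lambda(p)$. *)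

theory Defs
  imports Complex_Main
begin

text \<open>First Dirichlet eigenvalue of the one-dimensional \<open>p\<close>-Laplacian on \<open>(-1,1)\<close>, through its
  known closed form; meaningful only for \<open>p > 1\<close>.\<close>

definition eigval1 :: "real \<Rightarrow> real" where
  "eigval1 p = (p - 1) * (pi / (p * sin (pi / p))) powr p"

end

theory Submission
  imports Defs "HOL-Analysis.Gamma_Function"
begin

text \<open>
  Put \<open>s = 1 / p\<close> and \<open>c = pi\<^sup>2 / 6 = (\<Sum>k\<ge>1. 1 / k\<^sup>2)\<close>. By definition
  \<open>\<lambda>(p) / (p - 1)\<close> is the \<open>p\<close>-th power of the inverse of \<open>sin (\<pi> s) / (\<pi> s)\<close>, and Euler's product
  \<open>sin (\<pi> s) / (\<pi> s) = (\<Prod>k\<ge>1. 1 - s\<^sup>2 / k\<^sup>2)\<close> traps this quotient between two exponentials: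
  estimating each factor by \<open>exp (- t - 2/3 * t\<^sup>2) \<le> 1 - t \<le> exp (- t)\<close> with \<open>t = s\<^sup>2 / k\<^sup>2 \<le> 1/4\<close>
  gives, for \<open>0 < s \<le> 1/2\<close>,
  \<open>exp (- (c * s\<^sup>2 + (c + 3) / 6 * s ^ 4)) \<le> sin (\<pi> s) / (\<pi> s) \<le> exp (- c * s\<^sup>2)\<close>
  (lemmas \<open>exp_le_sinc\<close> and \<open>sinc_le_exp\<close>). Therefore
  \<open>exp (c * s) \<le> \<lambda>(p) / (p - 1) \<le> exp (c * s + (c + 3) / 6 * s ^ 3)\<close>,
  and since \<open>p / (p - 1) = 1 / (1 - s)\<close> and \<open>(p + c - 1) / (p - 1) = (1 + (c - 1) * s) / (1 - s)\<close>,
  the bounds for \<open>p \<ge> 2\<close> reduce to two elementary inequalities on \<open>0 < s \<le> 1/2\<close>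
  (lemmas \<open>inverse_one_minus_less_exp\<close> and \<open>exp_less_quotient\<close>), for which the crude estimates
  \<open>8/5 < c < 33/20\<close> suffice.

  The case \<open>1 < p < 2\<close> follows by duality: for the conjugate exponent \<open>q = p / (p - 1) > 2\<close> the
  sines of \<open>\<pi> / p\<close> and \<open>\<pi> / q\<close> coincide, whence \<open>\<lambda>(p) = \<lambda>(q) powr (p - 1)\<close> (lemma \<open>eigval1_conjugate\<close>).
\<close>

section \<open>Exponential bounds from Euler's sine product\<close>

lemma pi_squared_sixth_bounds: "8/5 < pi\<^sup>2 / 6" "pi\<^sup>2 / 6 < 33/20"
proof -
  have "(31/10)\<^sup>2 < pi\<^sup>2" "pi\<^sup>2 < (3.146)\<^sup>2"
    using pi_approx by (auto intro!: power_strict_mono)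
  then show "8/5 < pi\<^sup>2 / 6" "pi\<^sup>2 / 6 < 33/20"
    by (auto simp: power2_eq_square)
qed

lemma sum_inverse_squares_tendsto:
  "(\<lambda>n. \<Sum>k=1..n. s\<^sup>2 / (real k)\<^sup>2) \<longlonglongrightarrow> pi\<^sup>2 / 6 * s\<^sup>2"
proof -
  have "(\<lambda>n. \<Sum>k<n. 1 / (real k + 1)\<^sup>2) \<longlonglongrightarrow> pi\<^sup>2 / 6"
    using inverse_squares_sums by (simp add: sums_def add.commute)
  moreover have "(\<Sum>k<n. 1 / (real k + 1)\<^sup>2) = (\<Sum>k=1..n. 1 / (real k)\<^sup>2)" for n
    by (rule sum.reindex_bij_witness[of _ "\<lambda>k. k - 1" Suc]) (auto simp: add.commute)
  ultimately have "(\<lambda>n. (\<Sum>k=1..n. 1 / (real k)\<^sup>2) * s\<^sup>2) \<longlonglongrightarrow> pi\<^sup>2 / 6 * s\<^sup>2"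
    by (intro tendsto_mult tendsto_const) simp
  then show ?thesis
    by (simp add: sum_distrib_right)
qed

lemma euler_term_le_quarter:
  fixes s :: real
  assumes "0 < s" "s \<le> 1/2" "1 \<le> k"
  shows "s\<^sup>2 / (real k)\<^sup>2 \<le> 1/4"
proof -
  have "s\<^sup>2 \<le> (1/2)\<^sup>2" "1 \<le> (real k)\<^sup>2"
    using assms by (auto intro!: power_mono one_le_power)
  then show ?thesis
    by (simp add: divide_le_eq power2_eq_square)
qed

lemma sinc_le_exp:
  fixes s :: real
  assumes "0 < s" "s \<le> 1/2"
  shows "sin (pi * s) / (pi * s) \<le> exp (- (pi\<^sup>2 / 6 * s\<^sup>2))"
proof (rule LIMSEQ_le)
  show "(\<lambda>n. \<Prod>k=1..n. 1 - s\<^sup>2 / (real k)\<^sup>2) \<longlonglongrightarrow> sin (pi * s) / (pi * s)"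
    using sin_product_formula_real'[of s] assms by simp
  show "(\<lambda>n. exp (- (\<Sum>k=1..n. s\<^sup>2 / (real k)\<^sup>2))) \<longlonglongrightarrow> exp (- (pi\<^sup>2 / 6 * s\<^sup>2))"
    by (intro tendsto_exp tendsto_minus sum_inverse_squares_tendsto)
  have "(\<Prod>k=1..n. 1 - s\<^sup>2 / (real k)\<^sup>2) \<le> (\<Prod>k=1..n. exp (- (s\<^sup>2 / (real k)\<^sup>2)))" for n
  proof (rule prod_mono)
    fix k assume "k \<in> {1..n}"
    then have "s\<^sup>2 / (real k)\<^sup>2 \<le> 1/4"
      using euler_term_le_quarter[OF assms, of k] by simp
    then show "0 \<le> 1 - s\<^sup>2 / (real k)\<^sup>2 \<and> 1 - s\<^sup>2 / (real k)\<^sup>2 \<le> exp (- (s\<^sup>2 / (real k)\<^sup>2))"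
      using exp_ge_add_one_self[of "- (s\<^sup>2 / (real k)\<^sup>2)"] by linarith
  qed
  then show "\<exists>N. \<forall>n\<ge>N. (\<Prod>k=1..n. 1 - s\<^sup>2 / (real k)\<^sup>2) \<le> exp (- (\<Sum>k=1..n. s\<^sup>2 / (real k)\<^sup>2))"
    by (auto simp: exp_sum simp flip: sum_negf)
qed

lemma exp_le_one_minus:
  fixes t :: real
  assumes "0 \<le> t" "t \<le> 1/4"
  shows "exp (- (t + 2/3 * t\<^sup>2)) \<le> 1 - t"
proof -
  define y where "y = t + 2/3 * t\<^sup>2"
  have "0 \<le> t\<^sup>2 * ((1 - 4 * t) * (1 + t) / 6 + 2/9 * t\<^sup>2 * (1 - t))"
    using assms by (intro mult_nonneg_nonneg add_nonneg_nonneg divide_nonneg_pos) auto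
  also have "\<dots> = (1 - t) * (1 + y + y\<^sup>2 / 2) - 1"
    by (simp add: y_def field_simps power2_eq_square)
  also have "\<dots> \<le> (1 - t) * exp y - 1"
    using assms by (intro diff_right_mono mult_left_mono exp_lower_Taylor_quadratic)
      (auto simp: y_def)
  finally show ?thesis
    by (simp add: exp_minus y_def field_simps)
qed

lemma exp_le_sinc:
  fixes s :: real
  assumes "0 < s" "s \<le> 1/2"
  shows "exp (- (pi\<^sup>2 / 6 * s\<^sup>2 + (pi\<^sup>2 / 6 + 3) / 6 * s ^ 4)) \<le> sin (pi * s) / (pi * s)"
proof -
  define t where "t k = s\<^sup>2 / (real k)\<^sup>2" for k :: nat
  define M where "M n = (1 + s\<^sup>2 / 6) * (\<Sum>k=1..n. t k) + s ^ 4 / 2" for n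
  have t: "0 \<le> t k" "t k \<le> 1/4" if "k \<in> {1..n}" for k n
    using that euler_term_le_quarter[OF assms, of k] by (auto simp: t_def)
  \<comment> \<open>For \<open>k \<ge> 2\<close> one has \<open>(t k)\<^sup>2 \<le> s\<^sup>2 / 4 * t k\<close>; for \<open>k = 1\<close> this fails by \<open>3/4 * s ^ 4\<close>.\<close>
  have sq: "2/3 * (t k)\<^sup>2 \<le> s\<^sup>2 / 6 * t k + (if k = 1 then s ^ 4 / 2 else 0)" if "k \<in> {1..n}" for k n
  proof (cases "k = 1")
    case True
    then show ?thesis by (simp add: t_def power2_eq_square power4_eq_xxxx)
  next
    case False
    with that have "2\<^sup>2 \<le> (real k)\<^sup>2"
      by (intro power_mono) auto
    then have "t k \<le> s\<^sup>2 / 4"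
      unfolding t_def using that by (intro divide_left_mono) auto
    then have "t k * t k \<le> s\<^sup>2 / 4 * t k"
      using t(1)[OF that] by (intro mult_right_mono)
    then show ?thesis using False by (simp add: power2_eq_square)
  qed
  have le: "exp (- M n) \<le> (\<Prod>k=1..n. 1 - t k)" for n
  proof -
    have "(\<Sum>k=1..n. 2/3 * (t k)\<^sup>2) \<le> (\<Sum>k=1..n. s\<^sup>2 / 6 * t k + (if k = 1 then s ^ 4 / 2 else 0))"
      by (intro sum_mono sq)
    also have "\<dots> \<le> s\<^sup>2 / 6 * (\<Sum>k=1..n. t k) + s ^ 4 / 2"
      by (simp add: sum.distrib sum.delta sum_distrib_left)
    finally have "(\<Sum>k=1..n. t k + 2/3 * (t k)\<^sup>2) \<le> M n"
      by (simp add: M_def sum.distrib algebra_simps)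
    then have "exp (- M n) \<le> exp (\<Sum>k=1..n. - (t k + 2/3 * (t k)\<^sup>2))"
      by (simp only: sum_negf exp_le_cancel_iff neg_le_iff_le)
    also have "\<dots> = (\<Prod>k=1..n. exp (- (t k + 2/3 * (t k)\<^sup>2)))"
      by (simp add: exp_sum)
    also have "\<dots> \<le> (\<Prod>k=1..n. 1 - t k)"
      using t exp_le_one_minus by (intro prod_mono) auto
    finally show ?thesis .
  qed
  have "(\<lambda>n. exp (- M n)) \<longlonglongrightarrow> exp (- ((1 + s\<^sup>2 / 6) * (pi\<^sup>2 / 6 * s\<^sup>2) + s ^ 4 / 2))"
    unfolding M_def t_def
    by (intro tendsto_exp tendsto_minus tendsto_add tendsto_mult tendsto_const
        sum_inverse_squares_tendsto)
  moreover have "(\<lambda>n. \<Prod>k=1..n. 1 - t k) \<longlonglongrightarrow> sin (pi * s) / (pi * s)"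
    using sin_product_formula_real'[of s] assms by (simp add: t_def)
  ultimately have "exp (- ((1 + s\<^sup>2 / 6) * (pi\<^sup>2 / 6 * s\<^sup>2) + s ^ 4 / 2)) \<le> sin (pi * s) / (pi * s)"
    by (rule LIMSEQ_le) (use le in auto)
  moreover have "(1 + s\<^sup>2 / 6) * (pi\<^sup>2 / 6 * s\<^sup>2) + s ^ 4 / 2
      = pi\<^sup>2 / 6 * s\<^sup>2 + (pi\<^sup>2 / 6 + 3) / 6 * s ^ 4"
    by (simp add: field_simps power2_eq_square power4_eq_xxxx)
  ultimately show ?thesis by (simp only:)
qed

section \<open>Elementary inequalities\<close>

lemma inverse_one_minus_less_exp:
  fixes s c :: real
  assumes "0 < s" "s \<le> 1/2" "8/5 < c"
  shows "1 / (1 - s) < exp (c * s)"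
proof -
  define y where "y = 8/5 * s"
  have "s * s \<le> 1/2 * (1/2)"
    using assms by (intro mult_mono) auto
  then have "0 < s * (3/5 - 8/25 * s - 32/25 * (s * s))"
    using assms by (intro mult_pos_pos) auto
  also have "\<dots> = (1 - s) * (1 + y + y\<^sup>2 / 2) - 1"
    by (simp add: y_def field_simps power2_eq_square)
  also have "\<dots> \<le> (1 - s) * exp y - 1"
    using assms by (intro diff_right_mono mult_left_mono exp_lower_Taylor_quadratic)
      (auto simp: y_def)
  also have "\<dots> \<le> (1 - s) * exp (c * s) - 1"
    using assms by (intro diff_right_mono mult_left_mono) (auto simp: y_def)
  finally show ?thesis
    using assms by (simp add: field_simps)
qed

text \<open>
  Taking logarithms, the right-hand side minus the left-hand side vanishes at \<open>0\<close>, and its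
  derivative at \<open>x\<close> is
  \<open>x * (1 / (1 - x) - d\<^sup>2 / (1 + d * x) - (c + 3) / 2 * x)\<close> with \<open>d = c - 1\<close>. The cancellation of the
  terms that are constant in \<open>x\<close> is what makes \<open>pi\<^sup>2 / 6 - 1\<close> the right constant in the upper bound.
\<close>
lemma exp_less_quotient:
  fixes s c :: real
  assumes s: "0 < s" "s \<le> 1/2" and c: "1 \<le> c" "c < 33/20"
  shows "exp (c * s + (c + 3) / 6 * s ^ 3) < (1 + (c - 1) * s) / (1 - s)"
proof -
  define d where "d = c - 1"
  define F where "F x = ln (1 + d * x) - ln (1 - x) - (c * x + (c + 3) / 6 * x ^ 3)" for x
  have d: "0 \<le> d" "d < 13/20" using c by (auto simp: d_def)
  have pos: "0 < 1 + d * x" "0 < 1 - x" if "0 \<le> x" "x \<le> s" for x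
    using that s d by (auto intro: add_pos_nonneg)
  have "F 0 < F s"
  proof (rule DERIV_pos_imp_increasing_open[OF s(1)])
    fix x assume x: "0 < x" "x < s"
    note p = pos[of x]
    have "(F has_real_derivative
        (d / (1 + d * x) + 1 / (1 - x) - (c + (c + 3) / 6 * (3 * x\<^sup>2)))) (at x)"
      unfolding F_def using x p by (auto intro!: derivative_eq_intros)
    then have "(F has_real_derivative
        (d / (1 + d * x) + 1 / (1 - x) - (c + (c + 3) / 2 * x\<^sup>2))) (at x)"
      by simp
    moreover have "d / (1 + d * x) + 1 / (1 - x) - (c + (c + 3) / 2 * x\<^sup>2)
        = x * (1 / (1 - x) - d\<^sup>2 / (1 + d * x) - (c + 3) / 2 * x)"
      (is "_ = x * ?G")
    proof -
      have "d / (1 + d * x) = d - x * (d\<^sup>2 / (1 + d * x))" "1 / (1 - x) = 1 + x * (1 / (1 - x))"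
        using x p by (simp_all add: field_simps power2_eq_square)
      moreover have "x * ?G = x * (1 / (1 - x)) - x * (d\<^sup>2 / (1 + d * x)) - (c + 3) / 2 * x\<^sup>2"
        by (simp add: algebra_simps power2_eq_square)
      moreover have "c = d + 1"
        by (simp add: d_def)
      ultimately show ?thesis by linarith
    qed
    moreover have "0 < ?G"
    proof -
      have "1 + x + x\<^sup>2 \<le> 1 / (1 - x)"
        using x p by (simp add: field_simps power2_eq_square)
      moreover have "d\<^sup>2 / (1 + d * x) \<le> d\<^sup>2 / 1"
        using x d p by (intro divide_left_mono) auto
      moreover have "d\<^sup>2 \<le> (13/20)\<^sup>2"
        using d by (intro power_mono) auto
      moreover have "(c + 3) / 2 * x \<le> 93/40 * x"
        using x c by (intro mult_right_mono) auto
      \<comment> \<open>These bounds reduce the claim to the positivity of the quadratic \<open>x\<^sup>2 - 53/40 * x + 231/400\<close>,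
        which follows by completing the square.\<close>
      moreover have "0 \<le> x\<^sup>2 - 53/40 * x + 2809/6400"
        using zero_le_power2[of "x - 53/80"] by (simp add: power2_eq_square algebra_simps)
      moreover have "(13/20)\<^sup>2 = (169/400 :: real)"
        by (simp add: power2_eq_square)
      ultimately show ?thesis
        by linarith
    qed
    ultimately have "DERIV F x :> x * ?G" "0 < x * ?G"
      using x by (simp_all only: mult_pos_pos)
    then show "\<exists>y. DERIV F x :> y \<and> y > 0"
      by blast
  next
    have "1 + d * x \<noteq> 0" "1 - x \<noteq> 0" if "x \<in> {0..s}" for x
      using pos[of x] that by auto
    then show "continuous_on {0..s} F"
      unfolding F_def by (intro continuous_intros) blast+
  qed
  then have "c * s + (c + 3) / 6 * s ^ 3 < ln ((1 + d * s) / (1 - s))"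
    using pos[of s] s by (simp add: F_def ln_div)
  then have "exp (c * s + (c + 3) / 6 * s ^ 3) < exp (ln ((1 + d * s) / (1 - s)))"
    by (simp only: exp_less_cancel_iff)
  also have "\<dots> = (1 + d * s) / (1 - s)"
    using pos[of s] s by (intro exp_ln divide_pos_pos) auto
  finally show ?thesis
    by (simp only: d_def)
qed

section \<open>The two ranges of the exponent\<close>

lemma eigval1_bounds:
  assumes "2 \<le> p"
  shows "p < eigval1 p" "eigval1 p < p + pi\<^sup>2 / 6 - 1"
proof -
  define s where "s = 1 / p"
  define Q where "Q = sin (pi * s) / (pi * s)"
  define c where "c = pi\<^sup>2 / 6"
  have s: "0 < s" "s \<le> 1/2" and p: "0 < p" "p \<noteq> 0" "p = 1 / s"
    using assms by (auto simp: s_def field_simps)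
  have c: "8/5 < c" "c < 33/20"
    using pi_squared_sixth_bounds by (auto simp: c_def)
  have Q: "exp (- (c * s\<^sup>2 + (c + 3) / 6 * s ^ 4)) \<le> Q" "Q \<le> exp (- (c * s\<^sup>2))"
    using sinc_le_exp[OF s] exp_le_sinc[OF s] by (simp_all add: Q_def c_def)
  have "0 < Q" using Q(1) by (rule less_le_trans[rotated]) simp
  have eig: "eigval1 p = (p - 1) * (1 / Q) powr p"
    by (simp add: eigval1_def Q_def s_def mult.commute)
  have powr: "exp x powr p = exp (x * p)" for x
    by (simp add: powr_def)
  have "exp (c * s\<^sup>2) \<le> 1 / Q"
    using Q(2) \<open>0 < Q\<close> by (simp add: exp_minus field_simps)
  then have "exp (c * s\<^sup>2) powr p \<le> (1 / Q) powr p"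
    using p by (intro powr_mono2) auto
  moreover have "c * s\<^sup>2 * p = c * s"
    using s by (simp add: p(3) power2_eq_square)
  ultimately have lower: "exp (c * s) \<le> (1 / Q) powr p"
    by (simp only: powr)
  have "1 / Q \<le> exp (c * s\<^sup>2 + (c + 3) / 6 * s ^ 4)"
    using Q(1) \<open>0 < Q\<close> by (simp add: exp_minus field_simps)
  then have "(1 / Q) powr p \<le> exp (c * s\<^sup>2 + (c + 3) / 6 * s ^ 4) powr p"
    using p \<open>0 < Q\<close> by (intro powr_mono2) auto
  also have "(c * s\<^sup>2 + (c + 3) / 6 * s ^ 4) * p = c * s + (c + 3) / 6 * s ^ 3"
    using s by (simp add: p(3) field_simps power2_eq_square power3_eq_cube power4_eq_xxxx)
  then have "exp (c * s\<^sup>2 + (c + 3) / 6 * s ^ 4) powr p = exp (c * s + (c + 3) / 6 * s ^ 3)"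
    by (simp only: powr)
  finally have upper: "(1 / Q) powr p \<le> exp (c * s + (c + 3) / 6 * s ^ 3)" .
  have "1 / (1 - s) < (1 / Q) powr p"
    using inverse_one_minus_less_exp[OF s c(1)] lower by simp
  then have "(p - 1) * (1 / (1 - s)) < eigval1 p"
    unfolding eig using assms by (intro mult_strict_left_mono) auto
  also have "(p - 1) * (1 / (1 - s)) = p"
    using assms by (simp add: s_def field_simps)
  finally show "p < eigval1 p" .
  have "(1 / Q) powr p < (1 + (c - 1) * s) / (1 - s)"
    using exp_less_quotient[OF s _ c(2)] c upper by simp
  then have "eigval1 p < (p - 1) * ((1 + (c - 1) * s) / (1 - s))"
    unfolding eig using assms by (intro mult_strict_left_mono) auto
  also have "(p - 1) * ((1 + (c - 1) * s) / (1 - s)) = p + c - 1"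
    using assms by (simp add: s_def field_simps)
  finally show "eigval1 p < p + pi\<^sup>2 / 6 - 1"
    by (simp add: c_def)
qed

lemma eigval1_conjugate:
  assumes "1 < p"
  shows "eigval1 p = eigval1 (p / (p - 1)) powr (p - 1)"
proof -
  define q where "q = p / (p - 1)"
  define A where "A = pi / (p * sin (pi / p))"
  have q: "q - 1 = 1 / (p - 1)" "q * (p - 1) = p" "pi / q = pi - pi / p"
    using assms by (auto simp: q_def field_simps)
  have "0 < sin (pi / p)"
    using assms by (intro sin_gt_zero) (auto simp: field_simps)
  then have A: "0 < A"
    using assms by (simp add: A_def)
  have "sin (pi / q) = sin (pi / p)"
    unfolding q(3) by simp
  then have "pi / (q * sin (pi / q)) = (p - 1) * A"
    using assms by (simp add: A_def q_def)
  then have "eigval1 q powr (p - 1) = (1 / (p - 1) * ((p - 1) * A) powr q) powr (p - 1)"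
    by (simp add: eigval1_def q(1))
  also have "\<dots> = (1 / (p - 1)) powr (p - 1) * ((p - 1) * A) powr p"
    using assms A by (subst powr_mult) (simp_all only: powr_powr q(2))
  also have "\<dots> = (p - 1) powr (1 - p) * (p - 1) powr p * A powr p"
    using assms A by (simp add: powr_mult powr_divide powr_minus_divide[symmetric])
  also have "(p - 1) powr (1 - p) * (p - 1) powr p = p - 1"
    using assms by (simp flip: powr_add)
  finally show ?thesis
    by (simp add: eigval1_def A_def q_def)
qed

theorem theorem1p2:
  shows "(\<forall>p::real. 2 \<le> p \<longrightarrow> p < eigval1 p \<and> eigval1 p < p + pi\<^sup>2 / 6 - 1) \<and>
    (\<forall>p::real. 1 < p \<and> p < 2 \<longrightarrow>
       (p / (p - 1)) powr (p - 1) < eigval1 p \<and>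
       eigval1 p < (p - 1) powr (1 - p) * (1 + pi\<^sup>2 / 6 * (p - 1)) powr (p - 1))"
proof (intro conjI allI impI; (elim conjE)?)
  fix p :: real
  assume "2 \<le> p"
  then show "p < eigval1 p" "eigval1 p < p + pi\<^sup>2 / 6 - 1"
    by (rule eigval1_bounds)+
next
  fix p :: real
  assume p: "1 < p" "p < 2"
  define q where "q = p / (p - 1)"
  have "2 \<le> q" using p by (simp add: q_def field_simps)
  note q = eigval1_bounds[OF this]
  have eig: "eigval1 p = eigval1 q powr (p - 1)"
    using eigval1_conjugate[OF p(1)] by (simp add: q_def)
  show "(p / (p - 1)) powr (p - 1) < eigval1 p"
    unfolding eig q_def[symmetric] using p q \<open>2 \<le> q\<close> by (intro powr_less_mono2) auto
  have "eigval1 p < (q + pi\<^sup>2 / 6 - 1) powr (p - 1)"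
    unfolding eig using p q \<open>2 \<le> q\<close> by (intro powr_less_mono2) auto
  also have "q + pi\<^sup>2 / 6 - 1 = (1 + pi\<^sup>2 / 6 * (p - 1)) / (p - 1)"
    using p by (simp add: q_def field_simps)
  also have "\<dots> powr (p - 1) = (p - 1) powr (1 - p) * (1 + pi\<^sup>2 / 6 * (p - 1)) powr (p - 1)"
    using p powr_minus_divide[of "p - 1" "p - 1"] by (simp add: powr_divide)
  finally show "eigval1 p < (p - 1) powr (1 - p) * (1 + pi\<^sup>2 / 6 * (p - 1)) powr (p - 1)" .
qed

end
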